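(* Let $k\ge2$ and let $c_l,b_l$ ($l=1,\dots,k$) be respectively the nodes and the weights of the $k$-point Radau-right quadrature formula on $[0,1]$. Then, when $A\to0$, the method EFCM($k,k$) for $u'+Au=g(t,u)$, $u(0)=u_0$, reduces to the $k$-stage Radau IIA method for $u'=g(t,u)$, $u(0)=u_0$ (that is, the coefficients of EFCM($k,k$) tend to those of the $k$-stage Radau IIA method as $A\to0$).
   Context: Here $g:\mathbb R\times\mathbb R^d\to\mathbb R^d$ is analytic, $u_0\in\mathbb R^d$, and $A$ is a linear operator on $\mathbb R^d$ (a $d\times d$ matrix). The stepsize is $h>0$ and $V:=hA$. Shifted Legendre polynomials: $\widehat P_j(x)=(-1)^j\sqrt{2j+1}\sum_{i=0}^{j}\binom{j}{i}\binom{j+i}{i}(-x)^i$, so that $\int_0^1\widehat P_i\widehat P_j\,dx=\delta_{ij}$. $\varphi$-functions: $\varphi_0(z)=e^z$, $\varphi_i(z)=\int_0^1e^{(1-\sigma)z}\frac{\sigma^{i-1}}{(i-1)!}d\sigma$ for $i\ge1$. For nodes $c_1,\dots,c_k\in[0,1]$ and weights $b_1,\dots,b_k$ of a quadrature formula on $[0,1]$, EFCM($k,n$) (the $k$-stage exponential Fourier collocation method with integer $n$, $2\le n\le k$) is $$v_i=\varphi_0(-c_iV)u_0+c_ih\sum_{l=1}^kb_l\Big(\sum_{j=0}^{n-1}I_{j,c_i}(V)\widehat P_j(c_l)\Big)g(c_lh,v_l),\quad i=1,\dots,k,$$ $$v(h)=\varphi_0(-V)u_0+h\sum_{l=1}^kb_l\Big(\sum_{j=0}^{n-1}I_j(V)\widehat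 P_j(c_l)\Big)g(c_lh,v_l),$$ where $I_j(V)=\int_0^1\widehat P_j(z)e^{-(1-z)V}dz=\sqrt{2j+1}\sum_{i=0}^j(-1)^{j+i}\frac{(j+i)!}{i!(j-i)!}\varphi_{i+1}(-V)$ and $I_{j,c}(V)=\int_0^1\widehat P_j(cz)e^{-(1-z)cV}dz=(-1)^j\sqrt{2j+1}\sum_{i=0}^j(-c)^i\frac{(j+i)!}{i!(j-i)!}\varphi_{i+1}(-cV)$. EFCM($k,k$) is the case $n=k$. The $k$-point Radau-right quadrature on $[0,1]$ is the interpolatory quadrature whose nodes are the zeros of $\frac{d^{k-1}}{dx^{k-1}}\big(x^{k-1}(x-1)^k\big)$ (so $c_k=1$); it is exact for polynomials of degree up to $2k-2$. The $k$-stage Radau IIA method is the Runge–Kutta collocation method based on these nodes: $a_{ij}=\int_0^{c_i}\ell_j(\tau)d\tau$, $b_j=\int_0^1\ell_j(\tau)d\tau$, with $\ell_j$ the Lagrange basis polynomials for $c_1,\dots,c_k$. *)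

theory Defs
  imports "HOL-Analysis.Analysis" "HOL-Computational_Algebra.Polynomial"
begin

text \<open>Real analyticity in several variables: around every point, the function is the sum of an
  (unconditionally convergent) multivariate power series. A multi-index is a function on the
  basis vectors, normalised to 0 outside \<^const>\<open>Basis\<close>.\<close>

definition real_analytic ::
  "('a::euclidean_space \<Rightarrow> 'b::euclidean_space) \<Rightarrow> bool" where
  "real_analytic f \<longleftrightarrow>
     (\<forall>x. \<exists>r>0. \<exists>a :: ('a \<Rightarrow> nat) \<Rightarrow> 'b. \<forall>y\<in>ball x r.
        ((\<lambda>\<alpha>. (\<Prod>e\<in>Basis. ((y - x) \<bullet> e) ^ \<alpha> e) *\<^sub>R a \<alpha>) has_sum f y)
          {\<alpha>. \<forall>e. e \<notin> Basis \<longrightarrow> \<alpha> e = 0})"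

text \<open>Matrix exponential. The type of matrices is not an instance of
  \<^class>\<open>real_normed_algebra_1\<close> (and its pointwise product is not the matrix
  product), so the library's \<^const>\<open>exp\<close> does not apply.\<close>

definition mexp :: "real^'d^'d \<Rightarrow> real^'d^'d" where
  "mexp M = (\<Sum>n. (((**) M) ^^ n) (mat 1) /\<^sub>R fact n)"

definition shifted_legendre :: "nat \<Rightarrow> real \<Rightarrow> real" where
  "shifted_legendre j x = (-1) ^ j * sqrt (2 * real j + 1) *
     (\<Sum>i\<le>j. real (j choose i) * real ((j + i) choose i) * (- x) ^ i)"

text \<open>Lagrange basis polynomials for the nodes \<open>c 1, \<dots>, c k\<close>. As everywhere below, stages
  are numbered by \<open>{1..k}\<close>; other values of \<open>c\<close> and \<open>b\<close> are irrelevant.\<close>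

definition lagrange_basis :: "nat \<Rightarrow> (nat \<Rightarrow> real) \<Rightarrow> nat \<Rightarrow> real \<Rightarrow> real" where
  "lagrange_basis k c j x = (\<Prod>m\<in>{1..k} - {j}. (x - c m) / (c j - c m))"

definition radau_right_poly :: "nat \<Rightarrow> real poly" where
  "radau_right_poly k = (pderiv ^^ (k - 1)) ([:0, 1:] ^ (k - 1) * [:-1, 1:] ^ k)"

text \<open>\<open>c\<close>, \<open>b\<close> are the nodes and weights of the \<open>k\<close>-point Radau-right quadrature on
  \<open>[0,1]\<close>. The nodes are listed increasingly, so that \<open>c k = 1\<close>; the quadrature is
  interpolatory, i.e. it integrates the Lagrange interpolant at the nodes.\<close>

definition radau_right :: "nat \<Rightarrow> (nat \<Rightarrow> real) \<Rightarrow> (nat \<Rightarrow> real) \<Rightarrow> bool" where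
  "radau_right k c b \<longleftrightarrow>
     strict_mono_on {1..k} c \<and>
     c ` {1..k} = {x. poly (radau_right_poly k) x = 0} \<and>
     (\<forall>l\<in>{1..k}. b l = integral {0..1} (lagrange_basis k c l))"

text \<open>One step, of size \<open>h\<close>, of the Runge--Kutta method with coefficients \<open>a\<close>, \<open>b\<close>, \<open>c\<close> applied
  to \<open>u' = g(t,u)\<close>, \<open>u(0) = u0\<close>: \<open>v\<close> are the stages and \<open>u1\<close> is the numerical value at \<open>h\<close>.
  The stage equations are implicit, hence a relation.\<close>

definition rk_step ::
  "nat \<Rightarrow> (nat \<Rightarrow> nat \<Rightarrow> real) \<Rightarrow> (nat \<Rightarrow> real) \<Rightarrow> (nat \<Rightarrow> real) \<Rightarrow> real \<Rightarrow>
   (real \<Rightarrow> real^'d \<Rightarrow> real^'d) \<Rightarrow> real^'d \<Rightarrow> (nat \<Rightarrow> real^'d) \<Rightarrow> real^'d \<Rightarrow> bool" where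
  "rk_step k a b c h g u0 v u1 \<longleftrightarrow>
     (\<forall>i\<in>{1..k}. v i = u0 + h *\<^sub>R (\<Sum>l=1..k. a i l *\<^sub>R g (c l * h) (v l))) \<and>
     u1 = u0 + h *\<^sub>R (\<Sum>l=1..k. b l *\<^sub>R g (c l * h) (v l))"

definition collocation_a :: "nat \<Rightarrow> (nat \<Rightarrow> real) \<Rightarrow> nat \<Rightarrow> nat \<Rightarrow> real" where
  "collocation_a k c i j = integral {0..c i} (lagrange_basis k c j)"

definition collocation_b :: "nat \<Rightarrow> (nat \<Rightarrow> real) \<Rightarrow> nat \<Rightarrow> real" where
  "collocation_b k c j = integral {0..1} (lagrange_basis k c j)"

text \<open>\<open>I\<^sub>j\<^sub>,\<^sub>c(V)\<close>; the function \<open>I\<^sub>j(V)\<close> is the case \<open>c = 1\<close>.\<close>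

definition efcm_I :: "nat \<Rightarrow> real \<Rightarrow> real^'d^'d \<Rightarrow> real^'d^'d" where
  "efcm_I j c V =
     integral {0..1} (\<lambda>z. shifted_legendre j (c * z) *\<^sub>R mexp (- ((1 - z) * c) *\<^sub>R V))"

text \<open>The (matrix) coefficients of EFCM(k,n), as functions of \<open>V = hA\<close>: the factors
  \<open>\<phi>\<^sub>0(-c\<^sub>iV)\<close>, \<open>\<phi>\<^sub>0(-V)\<close> of \<open>u0\<close>, where \<open>\<phi>\<^sub>0\<close> is the exponential, and the factors of
  \<open>h g(c\<^sub>lh, v\<^sub>l)\<close> in the stages and in the update.\<close>

definition efcm_stage_init :: "(nat \<Rightarrow> real) \<Rightarrow> real^'d^'d \<Rightarrow> nat \<Rightarrow> real^'d^'d" where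
  "efcm_stage_init c V i = mexp (- c i *\<^sub>R V)"

definition efcm_init :: "real^'d^'d \<Rightarrow> real^'d^'d" where
  "efcm_init V = mexp (- V)"

definition efcm_a ::
  "nat \<Rightarrow> (nat \<Rightarrow> real) \<Rightarrow> (nat \<Rightarrow> real) \<Rightarrow> real^'d^'d \<Rightarrow> nat \<Rightarrow> nat \<Rightarrow> real^'d^'d" where
  "efcm_a n c b V i l =
     (c i * b l) *\<^sub>R (\<Sum>j<n. shifted_legendre j (c l) *\<^sub>R efcm_I j (c i) V)"

definition efcm_b ::
  "nat \<Rightarrow> (nat \<Rightarrow> real) \<Rightarrow> (nat \<Rightarrow> real) \<Rightarrow> real^'d^'d \<Rightarrow> nat \<Rightarrow> real^'d^'d" where
  "efcm_b n c b V l =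
     b l *\<^sub>R (\<Sum>j<n. shifted_legendre j (c l) *\<^sub>R efcm_I j 1 V)"

text \<open>One step of EFCM(k,n) for \<open>u' + A u = g(t,u)\<close>, \<open>u(0) = u0\<close>.\<close>

definition efcm_step ::
  "nat \<Rightarrow> nat \<Rightarrow> (nat \<Rightarrow> real) \<Rightarrow> (nat \<Rightarrow> real) \<Rightarrow> real \<Rightarrow> real^'d^'d \<Rightarrow>
   (real \<Rightarrow> real^'d \<Rightarrow> real^'d) \<Rightarrow> real^'d \<Rightarrow> (nat \<Rightarrow> real^'d) \<Rightarrow> real^'d \<Rightarrow> bool" where
  "efcm_step k n c b h A g u0 v u1 \<longleftrightarrow>
     (\<forall>i\<in>{1..k}. v i = efcm_stage_init c (h *\<^sub>R A) i *v u0 +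
        h *\<^sub>R (\<Sum>l=1..k. efcm_a n c b (h *\<^sub>R A) i l *v g (c l * h) (v l))) \<and>
     u1 = efcm_init (h *\<^sub>R A) *v u0 +
        h *\<^sub>R (\<Sum>l=1..k. efcm_b n c b (h *\<^sub>R A) l *v g (c l * h) (v l))"

end

theory Submission
  imports Defs
begin

text \<open>
  The coefficients of the method depend on \<open>A\<close> only through the matrix exponential, directly or under
  an integral over a compact interval. The exponential is continuous
  (\<open>continuous_on_mexp\<close>), so every coefficient is continuous in \<open>A\<close>, its limit is its value at
  \<open>A = 0\<close>, and the statement becomes an identity between numbers: with \<open>P\<^sub>j\<close> the orthonormal shifted
  Legendre polynomials and \<open>\<ell>\<^sub>l\<close> the Lagrange basis, \<open>c\<^sub>i b\<^sub>l \<Sum>\<^sub>j P\<^sub>j(c\<^sub>l) \<integral> P\<^sub>j(c\<^sub>i z) dz\<close>, with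
  \<open>j < k\<close> and \<open>z\<close> from \<open>0\<close> to \<open>1\<close>, must be the integral of \<open>\<ell>\<^sub>l\<close> from \<open>0\<close> to \<open>c\<^sub>i\<close>.

  Substituting \<open>x = c\<^sub>i z\<close> on the left, it suffices that \<open>\<Sum>\<^sub>j b\<^sub>l P\<^sub>j(c\<^sub>l) P\<^sub>j = \<ell>\<^sub>l\<close>
  (\<open>radau_right_legendre_expansion\<close>). Since \<open>\<ell>\<^sub>l\<close> has degree less than \<open>k\<close>, it equals its Legendre
  expansion up to degree \<open>k - 1\<close>, with coefficients \<open>\<integral> \<ell>\<^sub>l P\<^sub>j\<close>. The integrand has degree at
  most \<open>2 k - 2\<close>, so the Radau rule integrates it exactly (\<open>radau_right_exact\<close>), and as \<open>\<ell>\<^sub>l\<close> vanishes at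
  every node but \<open>c\<^sub>l\<close>, the coefficient is \<open>b\<^sub>l P\<^sub>j(c\<^sub>l)\<close>. The value \<open>c\<^sub>i = 1\<close> gives the update
  weights.

  The Legendre polynomials and the nodal polynomial of the Radau rule are both of the form
  \<open>D\<^sup>m (x\<^sup>m (x - 1)\<^sup>n)\<close> up to a factor. Repeated integration by parts for this form yields at once the
  orthonormality of the one and the orthogonality of the other to polynomials of degree less than
  \<open>k - 1\<close>, which is the source of the exactness. Its explicit coefficients identify the Legendre
  polynomials with their defining sums, and their alternating signs show that no node is negative.
\<close>

section \<open>Integrating polynomials over the unit interval\<close>

definition poly_integral :: "real poly \<Rightarrow> real" where
  "poly_integral p = integral {0..1} (\<lambda>x. poly p x)"

lemma poly_integrable [simp]: "poly p integrable_on {a..b}" for p :: "real poly"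
  by (intro integrable_continuous_interval continuous_intros)

lemma poly_integral_0 [simp]: "poly_integral 0 = 0"
  unfolding poly_integral_def poly_0 by simp

lemma poly_integral_add: "poly_integral (p + q) = poly_integral p + poly_integral q"
  unfolding poly_integral_def poly_add by (rule integral_add) simp_all

lemma poly_integral_diff: "poly_integral (p - q) = poly_integral p - poly_integral q"
  unfolding poly_integral_def poly_diff by (rule integral_diff) simp_all

lemma poly_integral_smult: "poly_integral (smult a p) = a * poly_integral p"
  unfolding poly_integral_def poly_smult by (rule integral_mult_right)

lemma poly_integral_sum: "poly_integral (\<Sum>i\<in>A. f i) = (\<Sum>i\<in>A. poly_integral (f i))"
  by (induction A rule: infinite_finite_induct) (simp_all add: poly_integral_add)

lemma poly_integral_pderiv: "poly_integral (pderiv p) = poly p 1 - poly p 0"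
proof -
  have "(poly (pderiv p) has_integral (poly p 1 - poly p 0)) {0..1}"
    by (rule fundamental_theorem_of_calculus)
       (auto simp: has_real_derivative_iff_has_vector_derivative [symmetric]
             intro: DERIV_subset[OF poly_DERIV])
  then show ?thesis
    unfolding poly_integral_def by (rule integral_unique)
qed

text \<open>Divisibility by powers of \<open>w\<close> keeps track of zeros of \<open>p\<close> at both endpoints simultaneously,
  with \<open>w = x (x - 1)\<close>.\<close>

lemma power_dvd_pderiv:
  fixes p w :: "real poly"
  assumes "w ^ Suc n dvd p"
  shows "w ^ n dvd pderiv p"
proof -
  obtain r where "p = w ^ Suc n * r"
    using assms by (elim dvdE)
  then have "pderiv p = w ^ n * (w * pderiv r + r * smult (of_nat (Suc n)) (pderiv w))"
    by (simp only: pderiv_mult pderiv_power_Suc) (simp add: algebra_simps)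
  then show ?thesis
    by (metis dvd_triv_left)
qed

lemma power_dvd_higher_pderiv:
  fixes p w :: "real poly"
  assumes "w ^ (n + m) dvd p"
  shows "w ^ n dvd (pderiv ^^ m) p"
  using assms
proof (induction m arbitrary: n)
  case (Suc m)
  then have "w ^ Suc n dvd (pderiv ^^ m) p"
    by (metis add_Suc add_Suc_right)
  then show ?case
    by (simp add: power_dvd_pderiv)
qed simp

text \<open>As \<open>u\<close> vanishes to order \<open>m\<close> at both endpoints, repeated integration by parts produces no
  boundary terms.\<close>

lemma poly_integral_by_parts:
  assumes "([:0, 1:] * [:-1, 1:]) ^ m dvd u"
  shows "poly_integral (q * (pderiv ^^ m) u) = (-1) ^ m * poly_integral ((pderiv ^^ m) q * u)"
  using assms
proof (induction m arbitrary: q)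
  case (Suc m)
  let ?w = "[:0, 1:] * [:-1, 1:] :: real poly" and ?v = "(pderiv ^^ m) u"
  have "?w ^ 1 dvd ?v"
    using Suc.prems by (intro power_dvd_higher_pderiv) simp
  then have "?w dvd ?v"
    by simp
  then have boundary: "poly ?v 0 = 0" "poly ?v 1 = 0"
    by (auto elim!: dvdE)
  have "poly_integral (q * (pderiv ^^ Suc m) u) =
      poly_integral (pderiv (q * ?v)) - poly_integral (pderiv q * ?v)"
    by (simp add: poly_integral_diff[symmetric] pderiv_mult algebra_simps)
  also have "\<dots> = - poly_integral (pderiv q * ?v)"
    by (simp add: poly_integral_pderiv boundary)
  also have "\<dots> = (-1) ^ Suc m * poly_integral ((pderiv ^^ m) (pderiv q) * u)"
    by (subst Suc.IH) (use dvd_trans[OF le_imp_power_dvd Suc.prems, of m] in simp_all)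
  finally show ?case
    by (simp only: funpow_Suc_right o_apply)
qed simp

lemma higher_pderiv_degree:
  fixes p :: "real poly"
  assumes "degree p \<le> m"
  shows "(pderiv ^^ m) p = [:fact m * coeff p m:]"
proof (rule poly_eqI)
  fix n
  show "coeff ((pderiv ^^ m) p) n = coeff [:fact m * coeff p m:] n"
    using assms
    by (cases n) (auto simp: coeff_higher_pderiv coeff_eq_0 pochhammer_fact)
qed

lemma poly_integral_beta:
  "poly_integral ([:0, 1:] ^ m * [:-1, 1:] ^ n) = (-1) ^ n * fact m * fact n / fact (m + n + 1)"
proof (induction n arbitrary: m)
  case 0
  have "[:0, 1:] ^ m = pderiv (smult (1 / (m + 1)) ([:0, 1:] ^ Suc m))"
    by (simp only: pderiv_smult pderiv_power_Suc) (simp add: pderiv_pCons)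
  then have "poly_integral ([:0, 1:] ^ m) = 1 / (m + 1)"
    by (simp only: poly_integral_pderiv) simp
  then show ?case
    by simp
next
  case (Suc n)
  define x y :: "real poly" where "x = [:0, 1:]" and "y = [:-1, 1:]"
  then have deriv: "pderiv x = 1" "pderiv y = 1"
    and boundary: "poly x 0 = 0" "poly y 1 = 0"
    by (simp_all add: pderiv_pCons)
  have "pderiv (x ^ Suc m * y ^ Suc n) =
      smult (m + 1) (x ^ m * y ^ Suc n) + smult (n + 1) (x ^ Suc m * y ^ n)"
    by (simp only: pderiv_mult pderiv_power_Suc) (simp add: deriv algebra_simps)
  moreover have "poly_integral (pderiv (x ^ Suc m * y ^ Suc n)) = 0"
    by (simp add: poly_integral_pderiv boundary)
  ultimately have "(m + 1) * poly_integral (x ^ m * y ^ Suc n) =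
      - (n + 1) * poly_integral (x ^ Suc m * y ^ n)"
    by (simp only: poly_integral_add poly_integral_smult)
  also have "\<dots> = - (n + 1) * ((-1) ^ n * fact (Suc m) * fact n / fact (Suc m + n + 1))"
    by (simp only: Suc.IH x_def y_def)
  also have "\<dots> = (m + 1) * ((-1) ^ Suc n * fact m * fact (Suc n) / fact (m + Suc n + 1))"
    by (simp add: algebra_simps)
  finally show ?case
    by (subst (asm) mult_cancel_left) (auto simp: x_def y_def)
qed

section \<open>Polynomials given by Rodrigues formulas\<close>

text \<open>The case \<open>m = n\<close> is the Legendre polynomial of degree \<open>n\<close> up to a factor, the case \<open>m = n - 1\<close>
  the nodal polynomial of the \<open>n\<close>-point Radau-right rule.\<close>

definition rodrigues :: "nat \<Rightarrow> nat \<Rightarrow> real poly" where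
  "rodrigues m n = (pderiv ^^ m) ([:0, 1:] ^ m * [:-1, 1:] ^ n)"

lemma coeff_rodrigues:
  "coeff (rodrigues m n) i = pochhammer (1 + real i) m * real (n choose i) * (-1) ^ (n - i)"
proof -
  have "coeff ([:-1, 1:] ^ n) i = real (n choose i) * (-1) ^ (n - i)"
  proof (cases "i \<le> n")
    case True
    then show ?thesis
      by (simp add: coeff_linear_poly_power)
  next
    case False
    then show ?thesis
      by (simp add: coeff_eq_0 degree_power_eq)
  qed
  moreover have "[:0, 1:] ^ m = (monom 1 m :: real poly)"
    by (simp add: monom_altdef)
  ultimately show ?thesis
    by (simp add: rodrigues_def coeff_higher_pderiv coeff_monom_mult)
qed

lemma degree_rodrigues: "degree (rodrigues m n) = n"
proof (rule antisym)
  show "degree (rodrigues m n) \<le> n"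
    by (rule degree_le) (simp add: coeff_rodrigues)
  have "pochhammer (1 + real n) m > 0"
    by (rule pochhammer_pos) simp
  then show "n \<le> degree (rodrigues m n)"
    by (intro le_degree) (simp add: coeff_rodrigues)
qed

lemma poly_rodrigues:
  "poly (rodrigues m n) x =
     (\<Sum>i\<le>n. pochhammer (1 + real i) m * real (n choose i) * (-1) ^ (n - i) * x ^ i)"
  by (simp add: poly_altdef degree_rodrigues coeff_rodrigues)

lemma alternating_sign_power:
  fixes x :: real
  assumes "i \<le> n"
  shows "(-1) ^ n * ((-1) ^ (n - i) * x ^ i) = (- x) ^ i"
proof -
  obtain d where "n = i + d"
    using assms le_Suc_ex by auto
  then show ?thesis
    by (simp add: power_add power_minus[of x])
qed

text \<open>The coefficients alternate in sign, so at a negative argument all terms of the sum have the same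
  sign. The collocation coefficients \<open>\<integral>\<^bsub>[0,c]\<^esub> \<ell>\<close> rely on this: for a negative \<open>c\<close> the interval
  \<open>{0..c}\<close> would be empty.\<close>

lemma rodrigues_root_nonneg:
  assumes "poly (rodrigues m n) x = 0"
  shows "x \<ge> 0"
proof (rule ccontr)
  assume "\<not> x \<ge> 0"
  have "(-1) ^ n * poly (rodrigues m n) x =
      (\<Sum>i\<le>n. pochhammer (1 + real i) m * real (n choose i) * (- x) ^ i)"
    unfolding poly_rodrigues sum_distrib_left
  proof (rule sum.cong)
    fix i
    assume "i \<in> {..n}"
    then have "(-1) ^ n * ((-1) ^ (n - i) * x ^ i) = (- x) ^ i"
      by (simp add: alternating_sign_power)
    then show "(-1) ^ n * (pochhammer (1 + real i) m * real (n choose i) * (-1) ^ (n - i) * x ^ i) =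
        pochhammer (1 + real i) m * real (n choose i) * (- x) ^ i"
      by (metis (no_types) mult.assoc mult.left_commute)
  qed simp
  also have "\<dots> > 0"
    using \<open>\<not> x \<ge> 0\<close>
    by (intro sum_pos mult_pos_pos pochhammer_pos zero_less_power) auto
  finally show False
    using assms by simp
qed

lemma poly_integral_rodrigues:
  assumes "m \<le> n"
  shows "poly_integral (q * rodrigues m n) =
    (-1) ^ m * poly_integral ((pderiv ^^ m) q * ([:0, 1:] ^ m * [:-1, 1:] ^ n))"
  unfolding rodrigues_def
proof (rule poly_integral_by_parts)
  show "([:0, 1:] * [:-1, 1:]) ^ m dvd [:0, 1:] ^ m * ([:-1, 1:] ^ n :: real poly)"
    unfolding power_mult_distrib using assms by (intro mult_dvd_mono le_imp_power_dvd) auto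
qed

text \<open>The \<open>m\<close>-th derivative of \<open>q\<close> vanishes.\<close>

lemma rodrigues_orthogonal:
  assumes "m \<le> n" "degree q < m"
  shows "poly_integral (q * rodrigues m n) = 0"
  using assms by (simp add: poly_integral_rodrigues higher_pderiv_degree coeff_eq_0)

text \<open>After integration by parts, only the constant \<open>j\<close>-th derivative of \<open>q\<close> and a beta integral
  remain. This gives the norm of the Legendre polynomials and, the factor being nonzero, their
  completeness.\<close>

lemma poly_integral_mult_rodrigues:
  assumes "degree q \<le> j"
  shows "poly_integral (q * rodrigues j j) = coeff q j * fact j ^ 3 / fact (2 * j + 1)"
proof -
  have "poly_integral (q * rodrigues j j) =
      (-1) ^ j * poly_integral (smult (fact j * coeff q j) ([:0, 1:] ^ j * [:-1, 1:] ^ j))"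
    using assms by (simp add: poly_integral_rodrigues higher_pderiv_degree)
  also have "\<dots> = coeff q j * fact j ^ 3 / fact (2 * j + 1)"
    unfolding poly_integral_smult poly_integral_beta by (simp add: power3_eq_cube flip: mult_2)
  finally show ?thesis .
qed

section \<open>Shifted Legendre polynomials\<close>

definition legendre_poly :: "nat \<Rightarrow> real poly" where
  "legendre_poly j = smult (sqrt (2 * real j + 1) / fact j) (rodrigues j j)"

lemma pochhammer_fact_quotient: "pochhammer (1 + real i) m = fact (i + m) / fact i"
  using pochhammer_product'[of "1 :: real" i m] by (simp flip: pochhammer_fact)

lemma poly_legendre_poly: "poly (legendre_poly j) = shifted_legendre j"
proof
  fix x
  have "pochhammer (1 + real i) j * real (j choose i) * (-1) ^ (j - i) * x ^ i / fact j =
      (-1) ^ j * (real (j choose i) * real ((j + i) choose i) * (- x) ^ i)" if "i \<le> j" for i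
  proof -
    have "pochhammer (1 + real i) j / fact j = real ((j + i) choose i)"
      by (simp add: pochhammer_fact_quotient binomial_fact add.commute)
    moreover have "(-1) ^ (j - i) * x ^ i = (-1) ^ j * (- x) ^ i"
      by (simp flip: alternating_sign_power[OF that])
    ultimately show ?thesis
      by (simp add: field_simps)
  qed
  then have "poly (rodrigues j j) x / fact j =
      (-1) ^ j * (\<Sum>i\<le>j. real (j choose i) * real ((j + i) choose i) * (- x) ^ i)"
    by (simp add: poly_rodrigues sum_divide_distrib sum_distrib_left)
  moreover have "poly (legendre_poly j) x =
      sqrt (2 * real j + 1) * (poly (rodrigues j j) x / fact j)"
    by (simp add: legendre_poly_def)
  ultimately show "poly (legendre_poly j) x = shifted_legendre j x"
    by (simp only: shifted_legendre_def mult_ac)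
qed

lemma degree_legendre_poly: "degree (legendre_poly j) = j"
  by (simp add: legendre_poly_def degree_rodrigues)

lemma legendre_poly_orthonormal:
  "poly_integral (legendre_poly i * legendre_poly j) = (if i = j then 1 else 0)"
proof -
  have lt: "poly_integral (legendre_poly i * legendre_poly j) = 0" if "i < j" for i j
    using rodrigues_orthogonal[of j j "legendre_poly i"] that
    by (simp add: legendre_poly_def[of j] poly_integral_smult degree_legendre_poly)
  have "poly_integral (legendre_poly j * legendre_poly j) = 1"
  proof -
    define a where "a = 2 * real j + 1"
    have a: "a > 0" "sqrt a * sqrt a = a" and f: "fact (2 * j + 1) = a * fact (2 * j)"
      by (simp_all add: a_def)
    have "poly_integral (legendre_poly j * legendre_poly j) =
        sqrt a * sqrt a / (fact j * fact j) *
          (pochhammer (1 + real j) j * fact j ^ 3 / fact (2 * j + 1))"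
      by (simp add: legendre_poly_def poly_integral_smult poly_integral_mult_rodrigues
          degree_rodrigues coeff_rodrigues a_def)
    also have "\<dots> = a / (fact j * fact j) *
        (fact (2 * j) / fact j * fact j ^ 3 / (a * fact (2 * j)))"
      unfolding a f pochhammer_fact_quotient by (simp flip: mult_2)
    also have "\<dots> = 1"
      using a by (simp add: power3_eq_cube)
    finally show ?thesis .
  qed
  with lt[of i j] lt[of j i] show ?thesis
    by (cases i j rule: linorder_cases) (auto simp: mult.commute)
qed

text \<open>The Legendre polynomial of the same degree as a nonzero \<open>p\<close> detects the leading coefficient
  of \<open>p\<close>.\<close>

lemma legendre_poly_complete:
  assumes "degree p < k" "\<And>j. j < k \<Longrightarrow> poly_integral (p * legendre_poly j) = 0"
  shows "p = 0"
proof -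
  have "poly_integral (p * legendre_poly (degree p)) = 0"
    using assms by simp
  then have "lead_coeff p = 0"
    by (simp add: legendre_poly_def poly_integral_smult poly_integral_mult_rodrigues)
  then show ?thesis
    by simp
qed

section \<open>Lagrange interpolation and Radau quadrature\<close>

definition lagrange_poly :: "nat \<Rightarrow> (nat \<Rightarrow> real) \<Rightarrow> nat \<Rightarrow> real poly" where
  "lagrange_poly k c j = (\<Prod>m\<in>{1..k} - {j}. smult (1 / (c j - c m)) [:- c m, 1:])"

lemma poly_lagrange_poly: "poly (lagrange_poly k c j) = lagrange_basis k c j"
proof
  show "poly (lagrange_poly k c j) x = lagrange_basis k c j x" for x
    unfolding lagrange_poly_def lagrange_basis_def poly_prod
    by (rule prod.cong) (auto simp flip: diff_divide_distrib)
qed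

lemma degree_lagrange_poly:
  assumes "j \<in> {1..k}"
  shows "degree (lagrange_poly k c j) \<le> k - 1"
proof -
  have "degree (lagrange_poly k c j) \<le>
      (\<Sum>m\<in>{1..k} - {j}. degree (smult (1 / (c j - c m)) [:- c m, 1:]))"
    unfolding lagrange_poly_def by (rule order.trans[OF degree_prod_sum_le]) (simp_all only: o_def finite_Diff finite_atLeastAtMost order.refl)
  also have "\<dots> \<le> (\<Sum>m\<in>{1..k} - {j}. 1)"
    by (intro sum_mono) (simp add: degree_smult_le)
  also have "\<dots> = k - 1"
    using assms by (simp add: card_Diff_singleton)
  finally show ?thesis .
qed

lemma poly_lagrange_poly_node:
  assumes "inj_on c {1..k}" "i \<in> {1..k}" "j \<in> {1..k}"
  shows "poly (lagrange_poly k c j) (c i) = (if i = j then 1 else 0)"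
proof -
  have "c j \<noteq> c m" if "m \<in> {1..k} - {j}" for m
    using that assms inj_onD by fastforce
  then show ?thesis
    using assms by (auto simp: poly_lagrange_poly lagrange_basis_def)
qed

lemma lagrange_interpolation:
  assumes inj: "inj_on c {1..k}" and "degree p < k"
  shows "p = (\<Sum>l=1..k. smult (poly p (c l)) (lagrange_poly k c l))"
proof (rule poly_eqI_degree)
  show "poly p x = poly (\<Sum>l=1..k. smult (poly p (c l)) (lagrange_poly k c l)) x"
    if "x \<in> c ` {1..k}" for x
  proof -
    obtain i where i: "i \<in> {1..k}" "x = c i"
      using \<open>x \<in> c ` {1..k}\<close> by (elim imageE) simp
    have "(\<Sum>l=1..k. poly p (c l) * poly (lagrange_poly k c l) (c i)) =
        (\<Sum>l=1..k. if l = i then poly p (c i) else 0)"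
      by (rule sum.cong) (use i(1) in \<open>auto simp: poly_lagrange_poly_node[OF inj]\<close>)
    then show ?thesis
      using i by (simp add: poly_sum)
  qed
  have card: "card (c ` {1..k}) = k"
    using inj by (simp add: card_image)
  then show "degree p < card (c ` {1..k})"
    using assms by simp
  have "degree (\<Sum>l=1..k. smult (poly p (c l)) (lagrange_poly k c l)) \<le> k - 1"
    by (intro degree_sum_le order.trans[OF degree_smult_le] degree_lagrange_poly) auto
  then show "degree (\<Sum>l=1..k. smult (poly p (c l)) (lagrange_poly k c l)) < card (c ` {1..k})"
    using assms card by linarith
qed

lemma radau_right_poly_rodrigues: "radau_right_poly k = rodrigues (k - 1) k"
  by (simp add: radau_right_poly_def rodrigues_def)

text \<open>Division by the nodal polynomial leaves a remainder that the interpolatory rule integrates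
  exactly. The quotient has degree at most \<open>k - 2\<close>, so the multiple of the nodal polynomial has
  integral \<open>0\<close> by the Rodrigues formula.\<close>

lemma radau_right_exact:
  assumes "k \<ge> 2" "radau_right k c b" "degree p \<le> 2 * k - 2"
  shows "poly_integral p = (\<Sum>l=1..k. b l * poly p (c l))"
proof -
  let ?R = "radau_right_poly k"
  define r where "r = p mod ?R"
  have inj: "inj_on c {1..k}"
    and roots: "\<And>l. l \<in> {1..k} \<Longrightarrow> poly ?R (c l) = 0"
    and weights: "\<And>l. l \<in> {1..k} \<Longrightarrow> b l = poly_integral (lagrange_poly k c l)"
    using assms(2)
    by (auto simp: radau_right_def poly_integral_def poly_lagrange_poly strict_mono_on_imp_inj_on)
  have degR: "degree ?R = k"
    by (simp add: radau_right_poly_rodrigues degree_rodrigues)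
  then have "?R \<noteq> 0"
    using assms(1) by auto
  have p: "p = (p div ?R) * ?R + r"
    by (simp add: r_def)
  have degr: "degree r < k"
    using degree_mod_less'[of ?R p] \<open>?R \<noteq> 0\<close> degR assms(1) unfolding r_def
    by (cases "p mod ?R = 0") auto
  have "degree (p div ?R) < k - 1"
  proof (cases "p div ?R = 0")
    case False
    have "p div ?R * ?R = p - r"
      by (simp add: r_def minus_mod_eq_div_mult)
    moreover have "degree (p - r) \<le> 2 * k - 2"
      using assms(1,3) degr by (intro degree_diff_le) auto
    ultimately have "degree (p div ?R * ?R) \<le> 2 * k - 2"
      by simp
    then show ?thesis
      using False \<open>?R \<noteq> 0\<close> degR assms(1) by (simp add: degree_mult_eq)
  qed (use assms(1) in simp)
  then have quot: "poly_integral ((p div ?R) * ?R) = 0"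
    unfolding radau_right_poly_rodrigues by (intro rodrigues_orthogonal) auto
  have "poly_integral p = poly_integral r"
    by (subst p) (simp add: poly_integral_add quot)
  also have "\<dots> = (\<Sum>l=1..k. poly r (c l) * poly_integral (lagrange_poly k c l))"
    using arg_cong[OF lagrange_interpolation[OF inj degr], of poly_integral]
    by (simp only: poly_integral_sum poly_integral_smult)
  also have "\<dots> = (\<Sum>l=1..k. b l * poly p (c l))"
  proof (rule sum.cong)
    fix l
    assume l: "l \<in> {1..k}"
    have "poly p (c l) = poly r (c l)"
      by (subst p) (simp add: roots[OF l])
    then show "poly r (c l) * poly_integral (lagrange_poly k c l) = b l * poly p (c l)"
      by (simp add: weights[OF l])
  qed simp
  finally show ?thesis .
qed

text \<open>The left-hand side is the Legendre expansion of the Lagrange polynomial: the coefficient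
  \<open>\<integral> \<ell>\<^sub>l P\<^sub>j\<close> is integrated exactly by the quadrature rule, which leaves only the node \<open>c l\<close>.
  Exactness to degree \<open>2 k - 2\<close> is just what the product of \<open>\<ell>\<^sub>l\<close> and \<open>P\<^sub>j\<close>, both of degree at most
  \<open>k - 1\<close>, requires.\<close>

lemma radau_right_legendre_expansion:
  assumes "k \<ge> 2" "radau_right k c b" "l \<in> {1..k}"
  shows "(\<Sum>j<k. smult (b l * shifted_legendre j (c l)) (legendre_poly j)) = lagrange_poly k c l"
    (is "?S = ?L")
proof -
  have inj: "inj_on c {1..k}"
    using assms(2) by (auto simp: radau_right_def strict_mono_on_imp_inj_on)
  have degL: "degree ?L \<le> k - 1"
    by (rule degree_lagrange_poly[OF assms(3)])
  have "?S - ?L = 0"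
  proof (rule legendre_poly_complete[where k = k])
    have "degree ?S \<le> k - 1"
      by (intro degree_sum_le order.trans[OF degree_smult_le]) (auto simp: degree_legendre_poly)
    then have "degree (?S - ?L) \<le> k - 1"
      using degL by (rule degree_diff_le)
    then show "degree (?S - ?L) < k"
      using assms(1) by linarith
    fix j
    assume j: "j < k"
    have "poly_integral (?S * legendre_poly j) =
        (\<Sum>i<k. b l * shifted_legendre i (c l) * (if i = j then 1 else 0))"
      by (simp add: sum_distrib_right poly_integral_sum poly_integral_smult
          legendre_poly_orthonormal)
    also have "\<dots> = b l * shifted_legendre j (c l)"
      using j by (simp add: if_distrib cong: if_cong)
    finally have S: "poly_integral (?S * legendre_poly j) = b l * shifted_legendre j (c l)" .
    have "degree (?L * legendre_poly j) \<le> 2 * k - 2"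
      using degree_mult_le[of ?L "legendre_poly j"] degL j by (simp add: degree_legendre_poly)
    then have "poly_integral (?L * legendre_poly j) =
        (\<Sum>m=1..k. b m * poly (?L * legendre_poly j) (c m))"
      by (rule radau_right_exact[OF assms(1,2)])
    also have "\<dots> = (\<Sum>m=1..k. if m = l then b l * shifted_legendre j (c l) else 0)"
      using assms(3)
      by (intro sum.cong) (auto simp: poly_lagrange_poly_node[OF inj] poly_legendre_poly)
    also have "\<dots> = b l * shifted_legendre j (c l)"
      using assms(3) by simp
    finally show "poly_integral ((?S - ?L) * legendre_poly j) = 0"
      using S by (simp add: left_diff_distrib poly_integral_diff)
  qed
  then show ?thesis
    by simp
qed

section \<open>Continuity of the matrix exponential and of the coefficients\<close>

lemma bounded_bilinear_matrix_mult:
  "bounded_bilinear ((**) :: real^'d^'d \<Rightarrow> real^'d^'d \<Rightarrow> real^'d^'d)"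
proof -
  have "(A + B) ** C = A ** C + B ** C" for A B C :: "real^'d^'d"
    by (simp add: matrix_matrix_mult_def vec_eq_iff distrib_right sum.distrib)
  then have "bilinear ((**) :: real^'d^'d \<Rightarrow> real^'d^'d \<Rightarrow> real^'d^'d)"
    unfolding bilinear_def
    by (intro conjI allI linearI)
       (simp_all add: matrix_add_ldistrib matrix_scalar_ac scalar_matrix_assoc[symmetric])
  then show ?thesis
    unfolding bilinear_conv_bounded_bilinear .
qed

text \<open>On a ball of radius \<open>r\<close> the exponential series is dominated by a multiple of the scalar series
  for \<open>exp (K r)\<close>, where \<open>K\<close> bounds the matrix product as a bilinear map. So it converges
  uniformly there.\<close>

lemma continuous_on_mexp: "continuous_on UNIV (mexp :: real^'d^'d \<Rightarrow> real^'d^'d)"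
proof -
  let ?pw = "\<lambda>n (M :: real^'d^'d). (((**) M) ^^ n) (mat 1)"
  interpret bounded_bilinear "(**) :: real^'d^'d \<Rightarrow> real^'d^'d \<Rightarrow> real^'d^'d"
    by (rule bounded_bilinear_matrix_mult)
  obtain K where K: "K > 0" "\<And>(A :: real^'d^'d) (B :: real^'d^'d). norm (A ** B) \<le> norm A * norm B * K"
    using pos_bounded by blast
  have cont: "continuous_on S (?pw n)" for n S
  proof (induction n)
    case (Suc n)
    then show ?case
      using continuous_on[OF continuous_on_id Suc] by simp
  qed simp
  have "continuous_on (ball 0 r) (mexp :: real^'d^'d \<Rightarrow> real^'d^'d)" for r :: real
  proof (cases "r \<ge> 0")
    case True
    have bound: "norm (?pw n M) \<le> norm (mat 1 :: real^'d^'d) * (K * r) ^ n"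
      if "M \<in> ball 0 r" for n and M :: "real^'d^'d"
    proof (induction n)
      case (Suc n)
      have "norm (?pw (Suc n) M) \<le> norm M * norm (?pw n M) * K"
        using K(2)[of M "?pw n M"] by simp
      also have "\<dots> \<le> r * (norm (mat 1 :: real^'d^'d) * (K * r) ^ n) * K"
        using that K(1) True Suc.IH by (intro mult_mono) auto
      finally show ?case
        by (simp add: algebra_simps)
    qed simp
    have "uniform_limit (ball 0 r) (\<lambda>n M. \<Sum>i<n. ?pw i M /\<^sub>R fact i)
        (\<lambda>M. suminf (\<lambda>i. ?pw i M /\<^sub>R fact i)) sequentially"
    proof (rule Weierstrass_m_test)
      show "norm (?pw n M /\<^sub>R fact n) \<le> norm (mat 1 :: real^'d^'d) * (inverse (fact n) * (K * r) ^ n)"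
        if "M \<in> ball 0 r" for n and M :: "real^'d^'d"
        using bound[OF that, of n] by (simp add: field_simps)
      show "summable (\<lambda>n. norm (mat 1 :: real^'d^'d) * (inverse (fact n) * (K * r) ^ n))"
        by (intro summable_mult summable_exp)
    qed
    moreover have "\<forall>\<^sub>F n in sequentially. continuous_on (ball 0 r) (\<lambda>M. \<Sum>i<n. ?pw i M /\<^sub>R fact i)"
      by (intro always_eventually allI continuous_intros cont)
    ultimately show ?thesis
      unfolding mexp_def[abs_def] by (intro uniform_limit_theorem[where F = sequentially]) auto
  qed (simp add: ball_empty)
  then have "continuous_on (\<Union>r. ball 0 r) (mexp :: real^'d^'d \<Rightarrow> real^'d^'d)"
    by (intro continuous_on_open_UN) auto
  moreover have "(\<Union>r. ball 0 r) = (UNIV :: (real^'d^'d) set)"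
  proof (intro set_eqI iffI)
    show "M \<in> (\<Union>r. ball 0 r)" for M :: "real^'d^'d"
      by (rule UN_I[of "norm M + 1"]) auto
  qed simp
  ultimately show ?thesis
    by simp
qed

lemma continuous_on_mexp_compose [continuous_intros]:
  assumes "continuous_on S f"
  shows "continuous_on S (\<lambda>x. mexp (f x :: real^'d^'d))"
  using continuous_on_compose2[OF continuous_on_mexp assms] by simp

lemma mexp_0: "mexp (0 :: real^'d^'d) = mat 1"
proof -
  have "(((**) (0 :: real^'d^'d)) ^^ n) (mat 1) /\<^sub>R fact n = (if n = 0 then mat 1 else 0)" for n
    by (cases n) auto
  then show ?thesis
    using suminf_finite[of "{0}" "\<lambda>n. (((**) (0 :: real^'d^'d)) ^^ n) (mat 1) /\<^sub>R fact n"]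
    by (simp add: mexp_def)
qed

lemma continuous_on_shifted_legendre [continuous_intros]:
  assumes "continuous_on S f"
  shows "continuous_on S (\<lambda>x. shifted_legendre j (f x))"
  unfolding poly_legendre_poly[symmetric] by (intro continuous_intros assms)

lemma continuous_on_efcm_I:
  "continuous_on UNIV (\<lambda>A. efcm_I j c (h *\<^sub>R A) :: real^'d^'d)"
  unfolding efcm_I_def box_real(2)[symmetric]
  by (rule integral_continuous_on_param) (auto simp: case_prod_beta intro!: continuous_intros)

lemma efcm_I_0:
  "efcm_I j c (0 :: real^'d^'d) = integral {0..1} (\<lambda>z. poly (legendre_poly j) (c * z)) *\<^sub>R mat 1"
proof -
  have "(\<lambda>z. poly (legendre_poly j) (c * z)) integrable_on {0..1}"
    by (intro integrable_continuous_interval continuous_intros)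
  then have "((\<lambda>z. poly (legendre_poly j) (c * z) *\<^sub>R (mat 1 :: real^'d^'d)) has_integral
      integral {0..1} (\<lambda>z. poly (legendre_poly j) (c * z)) *\<^sub>R mat 1) {0..1}"
    by (intro has_integral_scaleR_left integrable_integral)
  then show ?thesis
    by (simp add: efcm_I_def mexp_0 integral_unique flip: poly_legendre_poly)
qed

section \<open>The coefficients at the zero matrix\<close>

lemma integral_poly_stretch:
  fixes p :: "real poly"
  assumes "x \<ge> 0"
  shows "x * integral {0..1} (\<lambda>z. poly p (x * z)) = integral {0..x} (poly p)"
proof -
  have "((\<lambda>z. x *\<^sub>R poly p (x * z)) has_integral integral {x * 0..x * 1} (poly p)) {0..1}"
  proof (rule has_integral_substitution)
    show "(\<lambda>z. x * z) ` {0..1} \<subseteq> {0..x}"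
      using assms by (auto intro: mult_left_le)
  qed (use assms in \<open>auto intro!: continuous_intros derivative_eq_intros\<close>)
  from integral_unique[OF this] show ?thesis
    by simp
qed

text \<open>Stages (\<open>x = c i\<close>) and update (\<open>x = 1\<close>) at once: at the zero matrix, the sum is a scaled
  Legendre expansion of the Lagrange polynomial, integrated term by term.\<close>

lemma efcm_kernel_integral:
  assumes "k \<ge> 2" "radau_right k c b" "l \<in> {1..k}" "x \<ge> 0"
  shows "(x * b l) *\<^sub>R (\<Sum>j<k. shifted_legendre j (c l) *\<^sub>R efcm_I j x (0 :: real^'d^'d)) =
    integral {0..x} (lagrange_basis k c l) *\<^sub>R mat 1"
proof -
  let ?p = "\<lambda>j. legendre_poly j"
  have "integral {0..x} (lagrange_basis k c l) =
      integral {0..x} (\<lambda>t. \<Sum>j<k. b l * shifted_legendre j (c l) * poly (?p j) t)"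
    unfolding poly_lagrange_poly[symmetric] radau_right_legendre_expansion[OF assms(1-3), symmetric]
    by (intro integral_cong) (simp add: poly_sum)
  also have "\<dots> = (\<Sum>j<k. b l * shifted_legendre j (c l) * integral {0..x} (poly (?p j)))"
    by (subst integral_sum) (auto intro!: integrable_continuous_interval continuous_intros)
  also have "\<dots> = (\<Sum>j<k. x * b l * (shifted_legendre j (c l) *
      integral {0..1} (\<lambda>z. poly (?p j) (x * z))))"
    by (simp add: integral_poly_stretch[OF assms(4), symmetric] mult_ac)
  finally show ?thesis
    by (simp add: efcm_I_0 scaleR_sum_left scaleR_sum_right)
qed

lemma radau_right_node_nonneg:
  assumes "radau_right k c b" "i \<in> {1..k}"
  shows "c i \<ge> 0"
proof -
  have "c i \<in> {x. poly (radau_right_poly k) x = 0}"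
    using assms unfolding radau_right_def by blast
  then show ?thesis
    by (auto simp: radau_right_poly_rodrigues intro: rodrigues_root_nonneg)
qed

lemma efcm_a_0:
  assumes "k \<ge> 2" "radau_right k c b" "i \<in> {1..k}" "l \<in> {1..k}"
  shows "efcm_a k c b (0 :: real^'d^'d) i l = collocation_a k c i l *\<^sub>R mat 1"
  using efcm_kernel_integral[OF assms(1,2,4)] radau_right_node_nonneg[OF assms(2,3)]
  by (simp add: efcm_a_def collocation_a_def)

lemma efcm_b_0:
  assumes "k \<ge> 2" "radau_right k c b" "l \<in> {1..k}"
  shows "efcm_b k c b (0 :: real^'d^'d) l = collocation_b k c l *\<^sub>R mat 1"
  using efcm_kernel_integral[OF assms, of 1] by (simp add: efcm_b_def collocation_b_def)

lemma continuous_on_UNIV_tendsto: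
  assumes "continuous_on UNIV f" "f a = y"
  shows "(f \<longlongrightarrow> y) (at a)"
  using assms by (auto simp: continuous_on_def)

theorem theorem3p3:
  fixes k :: nat and c b :: "nat \<Rightarrow> real" and h :: real
    and g :: "real \<Rightarrow> real^'d \<Rightarrow> real^'d" and u0 :: "real^'d"
  assumes "k \<ge> 2"
    and "radau_right k c b"
    and "h > 0"
    and "real_analytic (\<lambda>(t, u). g t u)"
  shows "(\<forall>i\<in>{1..k}. ((\<lambda>A::real^'d^'d. efcm_stage_init c (h *\<^sub>R A) i) \<longlongrightarrow> mat 1) (at 0)) \<and>
    ((\<lambda>A::real^'d^'d. efcm_init (h *\<^sub>R A)) \<longlongrightarrow> mat 1) (at 0) \<and>
    (\<forall>i\<in>{1..k}. \<forall>l\<in>{1..k}.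
       ((\<lambda>A::real^'d^'d. efcm_a k c b (h *\<^sub>R A) i l) \<longlongrightarrow> collocation_a k c i l *\<^sub>R mat 1) (at 0)) \<and>
    (\<forall>l\<in>{1..k}.
       ((\<lambda>A::real^'d^'d. efcm_b k c b (h *\<^sub>R A) l) \<longlongrightarrow> collocation_b k c l *\<^sub>R mat 1) (at 0)) \<and>
    (\<forall>v u1. efcm_step k k c b h 0 g u0 v u1 \<longleftrightarrow>
       rk_step k (collocation_a k c) (collocation_b k c) c h g u0 v u1)"
proof (intro conjI ballI allI)
  show "((\<lambda>A::real^'d^'d. efcm_stage_init c (h *\<^sub>R A) i) \<longlongrightarrow> mat 1) (at 0)" for i
    by (rule continuous_on_UNIV_tendsto)
       (auto simp: efcm_stage_init_def mexp_0 intro!: continuous_intros)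
  show "((\<lambda>A::real^'d^'d. efcm_init (h *\<^sub>R A)) \<longlongrightarrow> mat 1) (at 0)"
    by (rule continuous_on_UNIV_tendsto)
       (auto simp: efcm_init_def mexp_0 intro!: continuous_intros)
  show "((\<lambda>A::real^'d^'d. efcm_a k c b (h *\<^sub>R A) i l) \<longlongrightarrow> collocation_a k c i l *\<^sub>R mat 1) (at 0)"
    if "i \<in> {1..k}" "l \<in> {1..k}" for i l
  proof (rule continuous_on_UNIV_tendsto)
    show "continuous_on UNIV (\<lambda>A::real^'d^'d. efcm_a k c b (h *\<^sub>R A) i l)"
      unfolding efcm_a_def by (intro continuous_intros continuous_on_efcm_I)
    show "efcm_a k c b (h *\<^sub>R (0 :: real^'d^'d)) i l = collocation_a k c i l *\<^sub>R mat 1"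
      using that assms by (simp add: efcm_a_0)
  qed
  show "((\<lambda>A::real^'d^'d. efcm_b k c b (h *\<^sub>R A) l) \<longlongrightarrow> collocation_b k c l *\<^sub>R mat 1) (at 0)"
    if "l \<in> {1..k}" for l
  proof (rule continuous_on_UNIV_tendsto)
    show "continuous_on UNIV (\<lambda>A::real^'d^'d. efcm_b k c b (h *\<^sub>R A) l)"
      unfolding efcm_b_def by (intro continuous_intros continuous_on_efcm_I)
    show "efcm_b k c b (h *\<^sub>R (0 :: real^'d^'d)) l = collocation_b k c l *\<^sub>R mat 1"
      using that assms by (simp add: efcm_b_0)
  qed
  show "efcm_step k k c b h 0 g u0 v u1 \<longleftrightarrow>
      rk_step k (collocation_a k c) (collocation_b k c) c h g u0 v u1" for v u1
    using assms(1,2)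
    by (simp add: efcm_step_def rk_step_def efcm_stage_init_def efcm_init_def mexp_0
        efcm_a_0 efcm_b_0 scaleR_matrix_vector_assoc[symmetric])
qed

end
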